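(* Let $G$ be a finite group, $\Bbbk$ a field of characteristic $0$ over which every ordinary representation of $G$ is defined, and $\alpha : G\to\Bbbk^{\times}$ a multiplicative character with $\alpha\neq 1$. If $H=\mathrm{Ker}\,\alpha$, then $\mathcal{L}(H)=\mathcal{L}(G)\cap\mathcal{L}_{\alpha}(G)$ inside $\Bbbk G$.
   Context: $\mathcal{L}_{\alpha}(G)$ is the Lie subalgebra of the group algebra $\Bbbk G$ (with bracket $[a,b]=ab-ba$) linearly spanned by the elements $g-\alpha(g)g^{-1}$, $g\in G$. For a finite group $K$, $\mathcal{L}(K)=\mathcal{L}_1(K)$ is the span in $\Bbbk K$ of the elements $g-g^{-1}$, $g\in K$. The algebra $\Bbbk H$, hence $\mathcal{L}(H)$, is viewed inside $\Bbbk G$. *)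

theory Defs
  imports
    "HOL-Algebra.Algebra"
    "HOL-Algebra.Algebraic_Closure_Type"
    "Jordan_Normal_Form.Matrix"
begin

abbreviation mult_group :: "'k::field itself \<Rightarrow> 'k monoid"
  where "mult_group _ \<equiv> units_of (ring_of_type_algebra :: 'k ring)"

abbreviation GL :: "'k::field itself \<Rightarrow> nat \<Rightarrow> 'k mat monoid"
  where "GL ty n \<equiv> units_of (ring_mat ty n ())"

text \<open>
  An ordinary (matrix) representation of \<open>G\<close> is one over the algebraic closure of the field \<open>'k\<close>
  of characteristic 0; it is defined over \<open>'k\<close> if it is equivalent to a representation
  all of whose matrix entries lie in \<open>'k\<close>.
\<close>
definition defined_over_base ::
    "('g, 'm) monoid_scheme \<Rightarrow> nat \<Rightarrow> ('g \<Rightarrow> 'k::field alg_closure mat) \<Rightarrow> bool"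
  where "defined_over_base G n \<rho> \<longleftrightarrow>
    (\<exists>\<sigma> \<in> hom G (GL TYPE('k) n). \<exists>P Q. \<forall>g \<in> carrier G.
       similar_mat_wit (\<rho> g) (map_mat to_ac (\<sigma> g)) P Q)"

definition all_reps_defined_over ::
    "('g, 'm) monoid_scheme \<Rightarrow> 'k::field itself \<Rightarrow> bool"
  where "all_reps_defined_over G ty \<longleftrightarrow>
    (\<forall>n. \<forall>\<rho> \<in> hom G (GL TYPE('k alg_closure) n). defined_over_base G n \<rho>)"

text \<open>
  Elements of the group algebra \<open>'k G\<close> are the finitely supported functions on the type
  \<open>'g\<close> whose support lies in the carrier of \<open>G\<close>. In particular the group algebra of a
  subgroup \<open>H\<close> of \<open>G\<close> is literally a subset of that of \<open>G\<close>. The multiplication provided by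
  the library for \<^typ>\<open>'g \<Rightarrow>\<^sub>0 'k\<close> is not used, since it refers to an additive monoid
  structure on the type \<open>'g\<close>.
\<close>
definition ga_scale :: "'k::field \<Rightarrow> ('g \<Rightarrow>\<^sub>0 'k) \<Rightarrow> ('g \<Rightarrow>\<^sub>0 'k)"
  where "ga_scale c a = Poly_Mapping.map ((*) c) a"

definition ga_mult :: "('g, 'm) monoid_scheme \<Rightarrow> ('g \<Rightarrow>\<^sub>0 'k::field) \<Rightarrow> ('g \<Rightarrow>\<^sub>0 'k) \<Rightarrow> ('g \<Rightarrow>\<^sub>0 'k)"
  where "ga_mult G a b =
    (\<Sum>x \<in> Poly_Mapping.keys a. \<Sum>y \<in> Poly_Mapping.keys b.
       Poly_Mapping.single (x \<otimes>\<^bsub>G\<^esub> y) (Poly_Mapping.lookup a x * Poly_Mapping.lookup b y))"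

definition group_algebra :: "('g, 'm) monoid_scheme \<Rightarrow> ('g \<Rightarrow>\<^sub>0 'k::field) ring"
  where "group_algebra G = \<lparr>
    carrier = {a. Poly_Mapping.keys a \<subseteq> carrier G},
    monoid.mult = ga_mult G,
    one = Poly_Mapping.single \<one>\<^bsub>G\<^esub> 1,
    ring.zero = 0,
    add = (+)\<rparr>"

definition ga_bracket :: "('g, 'm) monoid_scheme \<Rightarrow> ('g \<Rightarrow>\<^sub>0 'k::field) \<Rightarrow> ('g \<Rightarrow>\<^sub>0 'k) \<Rightarrow> ('g \<Rightarrow>\<^sub>0 'k)"
  where "ga_bracket G a b = a \<otimes>\<^bsub>group_algebra G\<^esub> b - b \<otimes>\<^bsub>group_algebra G\<^esub> a"

definition lie_gen :: "('g, 'm) monoid_scheme \<Rightarrow> ('g \<Rightarrow> 'k::field) \<Rightarrow> 'g \<Rightarrow> ('g \<Rightarrow>\<^sub>0 'k)"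
  where "lie_gen G \<alpha> g = Poly_Mapping.single g 1 - ga_scale (\<alpha> g) (Poly_Mapping.single (inv\<^bsub>G\<^esub> g) 1)"

text \<open>
  The linear span; that it is a Lie subalgebra of the group algebra is shown in
  \<open>lie_alpha_subset\<close> and \<open>lie_alpha_bracket_closed\<close> below.
\<close>
definition lie_alpha :: "('g, 'm) monoid_scheme \<Rightarrow> ('g \<Rightarrow> 'k::field) \<Rightarrow> ('g \<Rightarrow>\<^sub>0 'k) set"
  where "lie_alpha G \<alpha> = Modules.module.span ga_scale (lie_gen G \<alpha> ` carrier G)"

abbreviation lie_one :: "('g, 'm) monoid_scheme \<Rightarrow> ('g \<Rightarrow>\<^sub>0 'k::field) set"
  where "lie_one G \<equiv> lie_alpha G (\<lambda>_. 1)"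

lemma lookup_ga_scale [simp]:
  "Poly_Mapping.lookup (ga_scale c a) x = c * Poly_Mapping.lookup a x"
  unfolding ga_scale_def by transfer (simp add: when_def)

lemma ga_scale_single [simp]:
  "ga_scale c (Poly_Mapping.single g d) = Poly_Mapping.single g (c * d)"
  by (rule poly_mapping_eqI) (simp add: lookup_single when_def)

interpretation ga: vector_space "ga_scale :: 'k::field \<Rightarrow> ('g \<Rightarrow>\<^sub>0 'k) \<Rightarrow> _"
  by unfold_locales (auto intro!: poly_mapping_eqI simp: lookup_add algebra_simps)

lemma ga_mult_superset:
  assumes "finite A" "finite B" "Poly_Mapping.keys a \<subseteq> A" "Poly_Mapping.keys b \<subseteq> B"
  shows "ga_mult G a b =
    (\<Sum>x\<in>A. \<Sum>y\<in>B. Poly_Mapping.single (x \<otimes>\<^bsub>G\<^esub> y) (Poly_Mapping.lookup a x * Poly_Mapping.lookup b y))"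
proof -
  have "(\<Sum>y\<in>Poly_Mapping.keys b. Poly_Mapping.single (x \<otimes>\<^bsub>G\<^esub> y) (Poly_Mapping.lookup a x * Poly_Mapping.lookup b y))
      = (\<Sum>y\<in>B. Poly_Mapping.single (x \<otimes>\<^bsub>G\<^esub> y) (Poly_Mapping.lookup a x * Poly_Mapping.lookup b y))" for x
    using assms by (intro sum.mono_neutral_left) (auto simp: in_keys_iff)
  then show ?thesis
    unfolding ga_mult_def using assms
    by simp (intro sum.mono_neutral_left, auto simp: in_keys_iff)
qed

lemma ga_mult_add_left: "ga_mult G (a + b) c = ga_mult G a c + ga_mult G b c"
proof -
  have f: "finite (Poly_Mapping.keys a \<union> Poly_Mapping.keys b)" by simp
  show ?thesis
    by (subst (1 2 3) ga_mult_superset[OF f finite_keys[of c]])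
       (use Poly_Mapping.keys_add[of a b] in \<open>auto simp: lookup_add distrib_right single_add sum.distrib\<close>)
qed

lemma ga_mult_add_right: "ga_mult G c (a + b) = ga_mult G c a + ga_mult G c b"
proof -
  have f: "finite (Poly_Mapping.keys a \<union> Poly_Mapping.keys b)" by simp
  show ?thesis
    by (subst (1 2 3) ga_mult_superset[OF finite_keys[of c] f])
       (use Poly_Mapping.keys_add[of a b] in \<open>auto simp: lookup_add distrib_left single_add sum.distrib\<close>)
qed

lemma ga_mult_zero [simp]: "ga_mult G 0 a = 0" "ga_mult G a 0 = 0"
  by (simp_all add: ga_mult_def)

lemma ga_mult_sum_left: "ga_mult G (sum f A) c = (\<Sum>i\<in>A. ga_mult G (f i) c)"
  by (induction A rule: infinite_finite_induct) (auto simp: ga_mult_add_left)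

lemma ga_mult_sum_right: "ga_mult G c (sum f A) = (\<Sum>i\<in>A. ga_mult G c (f i))"
  by (induction A rule: infinite_finite_induct) (auto simp: ga_mult_add_right)

lemma ga_mult_single_left:
  "ga_mult G (Poly_Mapping.single x c) b =
    (\<Sum>y\<in>Poly_Mapping.keys b. Poly_Mapping.single (x \<otimes>\<^bsub>G\<^esub> y) (c * Poly_Mapping.lookup b y))"
  by (subst ga_mult_superset[of "{x}" "Poly_Mapping.keys b"]) auto

lemma ga_mult_single_right:
  "ga_mult G a (Poly_Mapping.single y c) =
    (\<Sum>x\<in>Poly_Mapping.keys a. Poly_Mapping.single (x \<otimes>\<^bsub>G\<^esub> y) (Poly_Mapping.lookup a x * c))"
  by (subst ga_mult_superset[of "Poly_Mapping.keys a" "{y}"]) auto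

lemma ga_mult_single_single [simp]:
  "ga_mult G (Poly_Mapping.single x c) (Poly_Mapping.single y d) = Poly_Mapping.single (x \<otimes>\<^bsub>G\<^esub> y) (c * d)"
  by (subst ga_mult_superset[of "{x}" "{y}"]) auto

lemma ga_mult_scale_left: "ga_mult G (ga_scale c a) b = ga_scale c (ga_mult G a b)"
  by (subst (1 2) ga_mult_superset[OF finite_keys[of a] finite_keys[of b]])
     (auto simp: in_keys_iff ga.scale_sum_right mult.assoc)

lemma ga_mult_scale_right: "ga_mult G a (ga_scale c b) = ga_scale c (ga_mult G a b)"
  by (subst (1 2) ga_mult_superset[OF finite_keys[of a] finite_keys[of b]])
     (auto simp: in_keys_iff ga.scale_sum_right mult.left_commute)

lemma ga_expand: "a = (\<Sum>x\<in>Poly_Mapping.keys a. Poly_Mapping.single x (Poly_Mapping.lookup a x))"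
  by (rule poly_mapping_eqI) (auto simp: lookup_sum lookup_single when_def in_keys_iff)

lemma keys_ga_mult:
  assumes "group G" "Poly_Mapping.keys a \<subseteq> carrier G" "Poly_Mapping.keys b \<subseteq> carrier G"
  shows "Poly_Mapping.keys (ga_mult G a b) \<subseteq> carrier G"
proof -
  interpret group G by fact
  show ?thesis
    unfolding ga_mult_def using assms(2,3)
    by (intro order.trans[OF Poly_Mapping.keys_sum] UN_least)
       (auto split: if_splits)
qed

lemma ga_mult_assoc:
  assumes "group G" and "Poly_Mapping.keys a \<subseteq> carrier G" "Poly_Mapping.keys b \<subseteq> carrier G" "Poly_Mapping.keys c \<subseteq> carrier G"
  shows "ga_mult G (ga_mult G a b) c = ga_mult G a (ga_mult G b c)"
proof -
  interpret group G by fact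
  let ?s = Poly_Mapping.single and ?l = Poly_Mapping.lookup
  have "ga_mult G (ga_mult G a b) c = (\<Sum>x\<in>Poly_Mapping.keys a. \<Sum>y\<in>Poly_Mapping.keys b. \<Sum>z\<in>Poly_Mapping.keys c.
      ?s (x \<otimes>\<^bsub>G\<^esub> y \<otimes>\<^bsub>G\<^esub> z) (?l a x * ?l b y * ?l c z))"
    unfolding ga_mult_def[of G a b] by (simp add: ga_mult_sum_left ga_mult_single_left)
  also have "\<dots> = (\<Sum>x\<in>Poly_Mapping.keys a. \<Sum>y\<in>Poly_Mapping.keys b. \<Sum>z\<in>Poly_Mapping.keys c.
      ?s (x \<otimes>\<^bsub>G\<^esub> (y \<otimes>\<^bsub>G\<^esub> z)) (?l a x * (?l b y * ?l c z)))"
    using assms(2-4) by (intro sum.cong refl) (auto simp: subset_iff m_assoc mult.assoc)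
  also have "\<dots> = (\<Sum>y\<in>Poly_Mapping.keys b. \<Sum>z\<in>Poly_Mapping.keys c. \<Sum>x\<in>Poly_Mapping.keys a.
      ?s (x \<otimes>\<^bsub>G\<^esub> (y \<otimes>\<^bsub>G\<^esub> z)) (?l a x * (?l b y * ?l c z)))"
    by (subst sum.swap, rule sum.cong[OF refl], rule sum.swap)
  also have "\<dots> = ga_mult G a (ga_mult G b c)"
    unfolding ga_mult_def[of G b c] by (simp add: ga_mult_sum_right ga_mult_single_right)
  finally show ?thesis .
qed

lemma ring_group_algebra:
  assumes "group G"
  shows "ring (group_algebra G :: ('g \<Rightarrow>\<^sub>0 'k::field) ring)"
proof -
  interpret group G by fact
  have one: "ga_mult G (Poly_Mapping.single \<one>\<^bsub>G\<^esub> 1) a = a" "ga_mult G a (Poly_Mapping.single \<one>\<^bsub>G\<^esub> 1) = a"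
    if "Poly_Mapping.keys a \<subseteq> carrier G" for a :: "'g \<Rightarrow>\<^sub>0 'k"
  proof -
    have "(\<Sum>x\<in>Poly_Mapping.keys a. Poly_Mapping.single (\<one>\<^bsub>G\<^esub> \<otimes>\<^bsub>G\<^esub> x) (1 * Poly_Mapping.lookup a x)) = a"
      using that by (subst (3) ga_expand[of a], intro sum.cong refl) (auto simp: subset_iff)
    then show "ga_mult G (Poly_Mapping.single \<one>\<^bsub>G\<^esub> 1) a = a" by (simp add: ga_mult_single_left)
    have "(\<Sum>x\<in>Poly_Mapping.keys a. Poly_Mapping.single (x \<otimes>\<^bsub>G\<^esub> \<one>\<^bsub>G\<^esub>) (Poly_Mapping.lookup a x * 1)) = a"
      using that by (subst (3) ga_expand[of a], intro sum.cong refl) (auto simp: subset_iff)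
    then show "ga_mult G a (Poly_Mapping.single \<one>\<^bsub>G\<^esub> 1) = a" by (simp add: ga_mult_single_right)
  qed
  have add: "Poly_Mapping.keys (a + b) \<subseteq> carrier G"
    if "Poly_Mapping.keys a \<subseteq> carrier G" "Poly_Mapping.keys b \<subseteq> carrier G" for a b :: "'g \<Rightarrow>\<^sub>0 'k"
    using that Poly_Mapping.keys_add[of a b] by blast
  have neg: "\<exists>b. Poly_Mapping.keys b \<subseteq> carrier G \<and> a + b = 0"
    if "Poly_Mapping.keys a \<subseteq> carrier G" for a :: "'g \<Rightarrow>\<^sub>0 'k"
    using that by (intro exI[of _ "-a"]) simp
  show ?thesis
  proof (rule ringI)
    show "abelian_group (group_algebra G :: ('g \<Rightarrow>\<^sub>0 'k) ring)"
      by (rule abelian_groupI) (auto simp: group_algebra_def add neg add_ac dest: add[THEN subsetD])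
    show "monoid (group_algebra G :: ('g \<Rightarrow>\<^sub>0 'k) ring)"
      by (rule monoidI)
         (auto simp: group_algebra_def one ga_mult_assoc[OF assms] dest: keys_ga_mult[OF assms, THEN subsetD])
  qed (auto simp: group_algebra_def ga_mult_add_left ga_mult_add_right)
qed

lemma lie_alpha_subset:
  fixes G :: "('a, 'm) monoid_scheme"
  assumes "group G"
  shows "lie_alpha G (\<alpha> :: 'a \<Rightarrow> 'b::field) \<subseteq> carrier (group_algebra G)"
proof -
  interpret group G by fact
  have "ga.subspace {a :: 'a \<Rightarrow>\<^sub>0 'b. Poly_Mapping.keys a \<subseteq> carrier G}"
  proof (rule ga.subspaceI)
    fix a b :: "'a \<Rightarrow>\<^sub>0 'b"
    assume "a \<in> {a. Poly_Mapping.keys a \<subseteq> carrier G}" "b \<in> {a. Poly_Mapping.keys a \<subseteq> carrier G}"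
    then show "a + b \<in> {a. Poly_Mapping.keys a \<subseteq> carrier G}"
      using Poly_Mapping.keys_add[of a b] by blast
  qed (auto simp: in_keys_iff subset_iff)
  moreover have "lie_gen G \<alpha> ` carrier G \<subseteq> {a. Poly_Mapping.keys a \<subseteq> carrier G}"
    by (auto simp: lie_gen_def in_keys_iff lookup_minus lookup_single when_def split: if_splits)
  ultimately show ?thesis
    by (simp add: lie_alpha_def group_algebra_def ga.span_minimal)
qed

lemma ga_mult_diff_left: "ga_mult G (a - b) c = ga_mult G a c - ga_mult G b c"
  using ga_mult_add_left[of G "a - b" b c] by (simp add: algebra_simps)

lemma ga_mult_diff_right: "ga_mult G c (a - b) = ga_mult G c a - ga_mult G c b"
  using ga_mult_add_right[of G c "a - b" b] by (simp add: algebra_simps)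

lemma ga_bracket_eq: "ga_bracket G a b = ga_mult G a b - ga_mult G b a"
  by (simp add: ga_bracket_def group_algebra_def)

lemma lie_alpha_bracket_closed:
  assumes "group G" and \<alpha>: "\<alpha> \<in> hom G (mult_group TYPE('k::field))"
    and a: "a \<in> lie_alpha G \<alpha>" and b: "b \<in> lie_alpha G \<alpha>"
  shows "ga_bracket G a b \<in> lie_alpha G \<alpha>"
proof -
  interpret group G by fact
  let ?L = "lie_alpha G \<alpha>" and ?s = Poly_Mapping.single
  have mult: "\<alpha> (g \<otimes>\<^bsub>G\<^esub> h) = \<alpha> g * \<alpha> h" and nz: "\<alpha> g \<noteq> 0"
    if "g \<in> carrier G" "h \<in> carrier G" for g h
    using \<alpha> that
    by (auto simp: hom_def units_of_def ring_of_type_algebra_def Units_def Pi_iff)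
  have "\<alpha> \<one>\<^bsub>G\<^esub> = 1"
    using mult[of "\<one>\<^bsub>G\<^esub>" "\<one>\<^bsub>G\<^esub>"] nz[of "\<one>\<^bsub>G\<^esub>" "\<one>\<^bsub>G\<^esub>"] by simp
  then have inv: "\<alpha> (inv\<^bsub>G\<^esub> g) * \<alpha> g = 1" if "g \<in> carrier G" for g
    using mult[of "inv\<^bsub>G\<^esub> g" g] that by simp
  have sub: "ga.subspace ?L"
    by (simp add: lie_alpha_def ga.subspace_span)
  have gen: "lie_gen G \<alpha> g \<in> ?L" if "g \<in> carrier G" for g
    using that by (auto simp: lie_alpha_def intro: ga.span_base)
  have gens: "ga_bracket G (lie_gen G \<alpha> g) (lie_gen G \<alpha> h) \<in> ?L"
    if gh: "g \<in> carrier G" "h \<in> carrier G" for g h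
  proof -
    have "ga_bracket G (lie_gen G \<alpha> g) (lie_gen G \<alpha> h) =
        lie_gen G \<alpha> (g \<otimes>\<^bsub>G\<^esub> h) - lie_gen G \<alpha> (h \<otimes>\<^bsub>G\<^esub> g)
        - ga_scale (\<alpha> h) (lie_gen G \<alpha> (g \<otimes>\<^bsub>G\<^esub> inv\<^bsub>G\<^esub> h))
        + ga_scale (\<alpha> h) (lie_gen G \<alpha> (inv\<^bsub>G\<^esub> h \<otimes>\<^bsub>G\<^esub> g))"
      using gh inv[of h]
      by (simp add: ga_bracket_eq lie_gen_def ga_mult_diff_left ga_mult_diff_right
          ga.scale_right_diff_distrib inv_mult_group mult mult.left_commute mult.commute)
    also have "\<dots> \<in> ?L"
      using gh by (intro ga.subspace_add ga.subspace_diff ga.subspace_scale sub gen) auto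
    finally show ?thesis .
  qed
  have right: "ga_bracket G (lie_gen G \<alpha> g) b \<in> ?L" if g: "g \<in> carrier G" for g
    using b unfolding lie_alpha_def[of G \<alpha>]
  proof (induction rule: ga.span_induct_alt)
    case base
    then show ?case by (simp add: ga_bracket_eq ga.span_zero)
  next
    case (step c x y)
    have "ga_bracket G (lie_gen G \<alpha> g) (ga_scale c x + y) =
        ga_scale c (ga_bracket G (lie_gen G \<alpha> g) x) + ga_bracket G (lie_gen G \<alpha> g) y"
      by (simp add: ga_bracket_eq ga_mult_add_left ga_mult_add_right ga_mult_scale_left
          ga_mult_scale_right ga.scale_right_diff_distrib)
    then show ?case
      using step gens[OF g] by (auto simp: lie_alpha_def intro!: ga.span_add ga.span_scale)
  qed
  show ?thesis
    using a unfolding lie_alpha_def[of G \<alpha>]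
  proof (induction rule: ga.span_induct_alt)
    case base
    then show ?case by (simp add: ga_bracket_eq ga.span_zero)
  next
    case (step c x y)
    have "ga_bracket G (ga_scale c x + y) b =
        ga_scale c (ga_bracket G x b) + ga_bracket G y b"
      by (simp add: ga_bracket_eq ga_mult_add_left ga_mult_add_right ga_mult_scale_left
          ga_mult_scale_right ga.scale_right_diff_distrib)
    then show ?case
      using step right by (auto simp: lie_alpha_def intro!: ga.span_add ga.span_scale)
  qed
qed

end

(* An element f of the group algebra lies in the span of the g - \<alpha>(g) g^-1 exactly when
   f(g^-1) = - \<alpha>(g) f(g) for all g; the converse direction averages, using that 2 is invertible.
   Imposing this for both 1 and \<alpha> gives \<alpha>(g) f(g) = f(g), so f is supported on Ker \<alpha>. *)
theory Submission
  imports Defs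
begin

lemma lookup_lie_gen:
  "Poly_Mapping.lookup (lie_gen G \<alpha> g) x =
    (if x = g then 1 else 0) - (if x = inv\<^bsub>G\<^esub> g then \<alpha> g else 0)"
  by (simp add: lie_gen_def lookup_minus lookup_single when_def)

text \<open>The condition on \<open>\<alpha>\<close> makes the symmetry consistent: applied at
  \<open>x\<close> and then at its inverse, it multiplies the coefficient at \<open>x\<close> by
  \<open>\<alpha> x * \<alpha> (inv x)\<close>. In this form the lemma covers the trivial character
  on \<open>H\<close> and on \<open>G\<close> as well as \<open>\<alpha>\<close> itself.\<close>

lemma lie_alpha_eq:
  fixes G :: "('g, 'm) monoid_scheme" and \<alpha> :: "'g \<Rightarrow> 'k::field_char_0"
  assumes "group G"
    and inv: "\<And>x. x \<in> carrier G \<Longrightarrow> \<alpha> x * \<alpha> (inv\<^bsub>G\<^esub> x) = 1"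
  shows "lie_alpha G \<alpha> = {f. Poly_Mapping.keys f \<subseteq> carrier G \<and>
    (\<forall>x\<in>carrier G. Poly_Mapping.lookup f (inv\<^bsub>G\<^esub> x) = - \<alpha> x * Poly_Mapping.lookup f x)}"
    (is "_ = {f. _ \<and> ?anti f}")
proof (intro equalityI subsetI)
  interpret group G by fact
  fix f assume f: "f \<in> lie_alpha G \<alpha>"
  \<comment> \<open>The symmetry is linear in \<open>f\<close>, so it suffices to check it on the
    generators.\<close>
  have "ga.subspace {f. ?anti f}"
    by (rule ga.subspaceI) (auto simp: lookup_add algebra_simps)
  moreover have "lie_gen G \<alpha> ` carrier G \<subseteq> {f. ?anti f}"
  proof clarify
    fix g x assume g: "g \<in> carrier G" and x: "x \<in> carrier G"
    have "inv\<^bsub>G\<^esub> x = g \<longleftrightarrow> x = inv\<^bsub>G\<^esub> g" "inv\<^bsub>G\<^esub> x = inv\<^bsub>G\<^esub> g \<longleftrightarrow> x = g"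
      using g x by (metis inv_inv)+
    \<comment> \<open>This settles \<open>x = inv g\<close>. If \<open>g\<close> is its own inverse,
      both case conditions hold at once, and it reads
      \<open>\<alpha> g * \<alpha> g = 1\<close>.\<close>
    moreover have "\<alpha> (inv\<^bsub>G\<^esub> g) * \<alpha> g = 1"
      using inv[OF g] by (simp only: mult.commute)
    ultimately show "Poly_Mapping.lookup (lie_gen G \<alpha> g) (inv\<^bsub>G\<^esub> x)
        = - \<alpha> x * Poly_Mapping.lookup (lie_gen G \<alpha> g) x"
      by (cases "x = g"; cases "x = inv\<^bsub>G\<^esub> g") (simp_all add: lookup_lie_gen right_diff_distrib)
  qed
  ultimately have "lie_alpha G \<alpha> \<subseteq> {f. ?anti f}"
    by (simp add: lie_alpha_def ga.span_minimal)
  with f lie_alpha_subset[OF \<open>group G\<close>, of \<alpha>]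
  show "f \<in> {f. Poly_Mapping.keys f \<subseteq> carrier G \<and> ?anti f}"
    by (auto simp: group_algebra_def)
next
  interpret group G by fact
  fix f assume "f \<in> {f. Poly_Mapping.keys f \<subseteq> carrier G \<and> ?anti f}"
  then have keys: "Poly_Mapping.keys f \<subseteq> carrier G" and anti: "?anti f"
    by blast+
  let ?K = "Poly_Mapping.keys f" and ?l = "Poly_Mapping.lookup f"
  \<comment> \<open>Each group element in the expansion of \<open>f\<close> is replaced by its
    generator. The subtracted terms add up to \<open>- f\<close> by the symmetry, so
    \<open>h\<close> is twice \<open>f\<close>.\<close>
  define h where "h = (\<Sum>x\<in>?K. ga_scale (?l x) (lie_gen G \<alpha> x))"
  have "h \<in> lie_alpha G \<alpha>"
    unfolding h_def lie_alpha_def using keys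
    by (intro ga.span_sum ga.span_scale ga.span_base) auto
  moreover have "f = ga_scale (1 / 2) h"
  proof (rule poly_mapping_eqI)
    fix y
    have "Poly_Mapping.lookup h y =
        (\<Sum>x\<in>?K. if x = y then ?l x else 0) - (\<Sum>x\<in>?K. if y = inv\<^bsub>G\<^esub> x then ?l x * \<alpha> x else 0)"
      unfolding h_def lookup_sum sum_subtractf[symmetric]
      by (intro sum.cong refl) (auto simp: lookup_lie_gen right_diff_distrib)
    also have "(\<Sum>x\<in>?K. if x = y then ?l x else 0) = ?l y"
      by (simp add: in_keys_iff)
    \<comment> \<open>Only \<open>x = inv y\<close> contributes. The symmetry at \<open>y\<close>
      turns its term into \<open>- \<alpha> y * \<alpha> (inv y) * ?l y\<close>.\<close>
    also have "(\<Sum>x\<in>?K. if y = inv\<^bsub>G\<^esub> x then ?l x * \<alpha> x else 0) = - ?l y"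
    proof (cases "y \<in> carrier G")
      case True
      have "(\<Sum>x\<in>?K. if y = inv\<^bsub>G\<^esub> x then ?l x * \<alpha> x else 0)
          = (\<Sum>x\<in>?K. if x = inv\<^bsub>G\<^esub> y then ?l x * \<alpha> x else 0)"
        using keys True by (intro sum.cong refl if_cong) auto
      also have "\<dots> = ?l (inv\<^bsub>G\<^esub> y) * \<alpha> (inv\<^bsub>G\<^esub> y)"
        by (simp add: in_keys_iff)
      also have "\<dots> = - ?l y"
        using anti True inv[OF True] by (simp add: mult.commute mult.left_commute)
      finally show ?thesis .
    \<comment> \<open>Outside the carrier nothing is known about \<open>inv y\<close>, but there
      \<open>f\<close> vanishes and \<open>y\<close> is not the inverse of any key.\<close>
    next
      case False
      then have "?l y = 0"
        using keys by (auto simp: in_keys_iff)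
      moreover have "y \<noteq> inv\<^bsub>G\<^esub> x" if "x \<in> ?K" for x
        using that keys False by auto
      ultimately show ?thesis
        by (auto intro!: sum.neutral)
    qed
    finally show "?l y = Poly_Mapping.lookup (ga_scale (1 / 2) h) y"
      by simp
  qed
  ultimately show "f \<in> lie_alpha G \<alpha>"
    by (simp add: lie_alpha_def ga.span_scale)
qed

theorem proposition1p4:
  fixes G :: "('g, 'm) monoid_scheme" and H :: "'g set"
    and \<alpha> :: "'g \<Rightarrow> 'k::field_char_0"
  assumes "group G" and "finite (carrier G)"
    and "all_reps_defined_over G TYPE('k)"
    and "\<alpha> \<in> hom G (mult_group TYPE('k))"
    and "\<exists>g \<in> carrier G. \<alpha> g \<noteq> 1"
    and "H = kernel G (mult_group TYPE('k)) \<alpha>"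
  shows "(lie_one (G\<lparr>carrier := H\<rparr>) :: ('g \<Rightarrow>\<^sub>0 'k) set) = lie_one G \<inter> lie_alpha G \<alpha>"
proof -
  interpret group G by fact
  have mult: "\<alpha> (g \<otimes>\<^bsub>G\<^esub> h) = \<alpha> g * \<alpha> h" and nz: "\<alpha> g \<noteq> 0"
    if "g \<in> carrier G" "h \<in> carrier G" for g h
    using assms(4) that
    by (auto simp: hom_def units_of_def ring_of_type_algebra_def Units_def Pi_iff)
  have one: "\<alpha> \<one>\<^bsub>G\<^esub> = 1"
    using mult[of "\<one>\<^bsub>G\<^esub>" "\<one>\<^bsub>G\<^esub>"] nz[of "\<one>\<^bsub>G\<^esub>" "\<one>\<^bsub>G\<^esub>"] by simp
  have inv: "\<alpha> x * \<alpha> (inv\<^bsub>G\<^esub> x) = 1" if "x \<in> carrier G" for x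
    using mult[of x "inv\<^bsub>G\<^esub> x"] one that by simp
  have H: "H = {x \<in> carrier G. \<alpha> x = 1}"
    using assms(6) by (simp add: kernel_def units_of_def ring_of_type_algebra_def)
  have inv_H: "inv\<^bsub>G\<^esub> x \<in> H \<longleftrightarrow> x \<in> H" if "x \<in> carrier G" for x
    using inv[OF that] that by (auto simp: H)
  have sub: "subgroup H G"
    using inv_H by (intro subgroupI) (use one in \<open>auto simp: H mult\<close>)
  let ?odd = "\<lambda>f. \<lambda>x. Poly_Mapping.lookup f (inv\<^bsub>G\<^esub> x) = - (Poly_Mapping.lookup f x :: 'k)"
  \<comment> \<open>On \<open>H\<close> the inverse of the subgroup is that of \<open>G\<close>, so
    the three descriptions can be compared coefficient by coefficient.\<close>
  have LH: "lie_one (G\<lparr>carrier := H\<rparr>) =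
      {f. Poly_Mapping.keys f \<subseteq> H \<and> (\<forall>x\<in>H. ?odd f x)}"
    using sub by (subst lie_alpha_eq) (auto simp: subgroup.subgroup_is_group m_inv_consistent is_group)
  have LG: "lie_one G = {f. Poly_Mapping.keys f \<subseteq> carrier G \<and> (\<forall>x\<in>carrier G. ?odd f x)}"
    by (subst lie_alpha_eq) (auto simp: is_group)
  have LA: "lie_alpha G \<alpha> = {f. Poly_Mapping.keys f \<subseteq> carrier G \<and>
      (\<forall>x\<in>carrier G. Poly_Mapping.lookup f (inv\<^bsub>G\<^esub> x) = - \<alpha> x * Poly_Mapping.lookup f x)}"
    using is_group inv by (rule lie_alpha_eq)
  show ?thesis
  proof (intro equalityI subsetI)
    fix f :: "'g \<Rightarrow>\<^sub>0 'k" assume "f \<in> lie_one (G\<lparr>carrier := H\<rparr>)"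
    then have keys: "Poly_Mapping.keys f \<subseteq> H" and odd: "\<And>x. x \<in> H \<Longrightarrow> ?odd f x"
      by (auto simp: LH)
    \<comment> \<open>On \<open>H\<close> both equations coincide, as \<open>\<alpha> x = 1\<close>.
      Off \<open>H\<close> both sides are zero, since the complement of \<open>H\<close> in
      \<open>G\<close> is closed under inverses.\<close>
    have both: "?odd f x \<and> Poly_Mapping.lookup f (inv\<^bsub>G\<^esub> x) = - \<alpha> x * Poly_Mapping.lookup f x"
      if x: "x \<in> carrier G" for x
    proof (cases "x \<in> H")
      case True
      then show ?thesis using odd by (simp add: H)
    next
      case False
      then have "Poly_Mapping.lookup f x = 0" "Poly_Mapping.lookup f (inv\<^bsub>G\<^esub> x) = 0"
        using keys inv_H[OF x] by (auto simp: in_keys_iff subset_iff)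
      then show ?thesis by simp
    qed
    have "Poly_Mapping.keys f \<subseteq> carrier G"
      using keys by (auto simp: H)
    then show "f \<in> lie_one G \<inter> lie_alpha G \<alpha>"
      unfolding LG LA using both by blast
  next
    fix f assume f: "f \<in> lie_one G \<inter> lie_alpha G \<alpha>"
    have "\<alpha> x = 1" if "x \<in> Poly_Mapping.keys f" for x
    proof -
      have "x \<in> carrier G"
        using that f by (auto simp: LG)
      \<comment> \<open>Both sides equal the coefficient at \<open>inv x\<close>. On the support the
        factor \<open>lookup f x\<close> is nonzero and cancels.\<close>
      then have "- Poly_Mapping.lookup f x = - \<alpha> x * Poly_Mapping.lookup f x"
        using f unfolding LG LA by (metis (mono_tags, lifting) IntE mem_Collect_eq)
      then show ?thesis
        using that by (simp add: in_keys_iff)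
    qed
    then show "f \<in> lie_one (G\<lparr>carrier := H\<rparr>)"
      using f unfolding LH LG by (auto simp: H)
  qed
qed

end
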